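(* Let $\gamma>0$ and let $f:\mathbb{N}\to(0,\infty)$ be a nonincreasing function such that (i) $\lim_{n\to\infty} \frac{f(n)}{f(n+1)}=\gamma$ and $\sum_{n\ge 0}\gamma^n f(n)<\infty$; (ii) the sequence $n\mapsto \gamma^n f(n)$ is nonincreasing; (iii) there is a function $C:\mathbb{N}\to\mathbb{R}$ such that for every integer $\ell\ge 1$ and every $n\in\mathbb{N}$ divisible by $\ell$, $\gamma^{n/\ell} f(n/\ell)\le C(\ell)\,\gamma^{n} f(n)$. Then for each integer $m\ge 2$, the sequence of probability measures $\hat\nu_{m-1,n}$ on $\mathcal{X}_{m-1}$ converges weakly to the probability measure $\hat\mu_{m-1,\gamma}$ on $\mathcal{X}_{m-1}$ as $n\to\infty$ (where $\mathcal{X}_{m-1}$ is a countable set with the discrete topology).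
   Context: $\mathbb{N}=\{0,1,2,\dots\}$. For $\xi=(\xi_1,\dots,\xi_m)\in\mathbb{N}^m$ write $|\xi|=\xi_1+\cdots+\xi_m$. Partition function: $Z(\varphi)=\sum_{n\ge0}\varphi^n f(n)$, which is finite for $0\le\varphi\le\gamma$. Grand canonical measure: for $m\ge 1$ and $0\le\varphi\le\gamma$, $\mu_{m,\varphi}$ is the product probability measure on $\mathbb{N}^m$ given by $\mu_{m,\varphi}(\xi)=Z(\varphi)^{-m}\prod_{j=1}^m \varphi^{\xi_j}f(\xi_j)$. Canonical measure: for $n\ge0$, $\nu_{m,n}(\xi)=\mu_{m,\varphi}(\xi\mid |\xi|=n)$ for any $0<\varphi\le\gamma$; it does not depend on $\varphi$. Equivalently, $\nu_{m,n}$ is the probability measure on $\{\xi\in\mathbb{N}^m: |\xi|=n\}$ with $\nu_{m,n}(\xi)$ proportional to $\prod_{j=1}^m f(\xi_j)$. Ordered configurations: $\mathcal{X}_m=\{\zeta\in\mathbb{N}^m:\zeta_1\le\cdots\le\zeta_m\}$. The order operator $\mathsf{O}:\mathbb{N}^m\to\mathcal{X}_m$ rearranges the coordinates of $\xi$ in nondecreasing order: $(\mathsf{O}\xi)_i\le(\mathsf{O}\xi)_j$ for $i\le j$, and $(\mathsf{O}\xi)_i=\xi_{\sigma(i)}$ for some permutation $\sigma$ of $\{1,\dots,m\}$. The cut operator $\mathsf{C}:\mathbb{N}^m\to\mathbb{N}^{m-1}$ deletes the last coordinate: $(\mathsf{C}\xi)_i=\xi_i$ for $1\le i\le m-1$.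 Induced measures: $\hat\mu_{m,\varphi}=\mu_{m,\varphi}\circ\mathsf{O}^{-1}$ is the push-forward of $\mu_{m,\varphi}$ under $\mathsf{O}$, a probability measure on $\mathcal{X}_m$; and $\hat\nu_{m-1,n}=\nu_{m,n}\circ(\mathsf{C}\circ\mathsf{O})^{-1}$ is the push-forward of $\nu_{m,n}$ under $\mathsf{C}\circ\mathsf{O}$, a probability measure on $\mathcal{X}_{m-1}$ (sample from $\nu_{m,n}$, order the coordinates, and remove the largest one). *)

theory Defs
  imports "HOL-Probability.Probability"
begin

text \<open>A configuration in \<open>\<nat>\<^sup>m\<close> is a list of length \<open>m\<close>, so \<open>\<bar>\<xi>\<bar>\<close> is \<^const>\<open>sum_list\<close>,
  the order operator \<open>O\<close> is \<^const>\<open>sort\<close> and the cut operator \<open>C\<close> is \<^const>\<open>butlast\<close>.\<close>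

definition configs :: "nat \<Rightarrow> nat list set" where
  "configs m = {\<xi>. length \<xi> = m}"

definition ordered_configs :: "nat \<Rightarrow> nat list set" where
  "ordered_configs m = {\<zeta> \<in> configs m. sorted \<zeta>}"

definition partition_function :: "(nat \<Rightarrow> real) \<Rightarrow> real \<Rightarrow> real" where
  "partition_function f \<phi> = (\<Sum>n. \<phi> ^ n * f n)"

definition grand_canonical :: "(nat \<Rightarrow> real) \<Rightarrow> real \<Rightarrow> nat \<Rightarrow> nat list measure" where
  "grand_canonical f \<phi> m =
     point_measure (configs m)
       (\<lambda>\<xi>. ennreal ((\<Prod>k\<leftarrow>\<xi>. \<phi> ^ k * f k) / partition_function f \<phi> ^ m))"

text \<open>The canonical measure is given by its weights, normalised on the finite set of
  configurations with total \<open>n\<close>. For \<open>m \<ge> 1\<close> it is the grand canonical measure conditioned on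
  \<open>\<bar>\<xi>\<bar> = n\<close>, at every admissible \<open>\<phi>\<close>: see \<open>canonical_eq_conditional\<close> below.\<close>

definition canonical :: "(nat \<Rightarrow> real) \<Rightarrow> nat \<Rightarrow> nat \<Rightarrow> nat list measure" where
  "canonical f m n =
     point_measure (configs m)
       (\<lambda>\<xi>. if sum_list \<xi> = n
            then ennreal ((\<Prod>k\<leftarrow>\<xi>. f k) / (\<Sum>\<eta> | \<eta> \<in> configs m \<and> sum_list \<eta> = n. \<Prod>k\<leftarrow>\<eta>. f k))
            else 0)"

definition ordered_grand_canonical :: "(nat \<Rightarrow> real) \<Rightarrow> real \<Rightarrow> nat \<Rightarrow> nat list measure" where
  "ordered_grand_canonical f \<phi> m =
     distr (grand_canonical f \<phi> m) (count_space (ordered_configs m)) sort"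

text \<open>The index \<open>k\<close> is the number of coordinates left after the cut: \<open>k = m - 1\<close>.\<close>

definition cut_canonical :: "(nat \<Rightarrow> real) \<Rightarrow> nat \<Rightarrow> nat \<Rightarrow> nat list measure" where
  "cut_canonical f k n =
     distr (canonical f (Suc k) n) (count_space (ordered_configs k)) (butlast \<circ> sort)"

text \<open>Weak convergence of probability measures on a topological space, tested against bounded
  continuous functions. (The library's \<^const>\<open>weak_conv_m\<close> is only for measures on the reals.)\<close>

definition weakly_converges :: "'a topology \<Rightarrow> (nat \<Rightarrow> 'a measure) \<Rightarrow> 'a measure \<Rightarrow> bool" where
  "weakly_converges T \<mu> M \<longleftrightarrow>
     (\<forall>g :: 'a \<Rightarrow> real. continuous_map T euclideanreal g \<and> bounded (g ` topspace T) \<longrightarrow>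
        (\<lambda>n. integral\<^sup>L (\<mu> n) g) \<longlonglongrightarrow> integral\<^sup>L M g)"

subsection \<open>The measures are well defined\<close>

lemma summable_le_radius:
  fixes f :: "nat \<Rightarrow> real"
  assumes "\<And>n. f n > 0" "summable (\<lambda>n. \<gamma> ^ n * f n)" "0 \<le> \<phi>" "\<phi> \<le> \<gamma>"
  shows "summable (\<lambda>n. \<phi> ^ n * f n)"
proof (rule summable_comparison_test'[OF assms(2), of 0])
  fix n
  show "norm (\<phi> ^ n * f n) \<le> \<gamma> ^ n * f n"
    using assms(1)[of n] assms(3,4)
    by (auto simp: abs_mult intro!: mult_right_mono power_mono)
qed

lemma partition_function_pos:
  assumes "\<And>n. f n > 0" "summable (\<lambda>n. \<phi> ^ n * f n)" "0 \<le> \<phi>"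
  shows "partition_function f \<phi> > 0"
  unfolding partition_function_def
  by (rule suminf_pos2[OF assms(2), of 0]) (use assms in \<open>auto simp: less_imp_le\<close>)

lemma prod_list_map_nonneg:
  "(\<And>k. (w k :: real) \<ge> 0) \<Longrightarrow> (\<Prod>k\<leftarrow>\<xi>. w k) \<ge> 0"
  by (induction \<xi>) auto

lemma prod_list_map_pos:
  "(\<And>k. (w k :: real) > 0) \<Longrightarrow> (\<Prod>k\<leftarrow>\<xi>. w k) > 0"
  by (induction \<xi>) auto

lemma configs_Suc: "configs (Suc m) = case_prod Cons ` (UNIV \<times> configs m)"
  by (auto simp: configs_def length_Suc_conv image_iff)

lemma nn_integral_configs:
  assumes w: "\<And>n. (w n :: real) \<ge> 0" and s: "summable w"
  shows "(\<integral>\<^sup>+\<xi>. ennreal (\<Prod>k\<leftarrow>\<xi>. w k) \<partial>count_space (configs m)) = ennreal ((\<Sum>n. w n) ^ m)"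
proof (induction m)
  case 0
  have "configs 0 = {[]}" by (auto simp: configs_def)
  then show ?case by (simp add: nn_integral_count_space_finite)
next
  case (Suc m)
  have "bij_betw (case_prod Cons) (UNIV \<times> configs m) (configs (Suc m))"
    unfolding configs_Suc by (auto simp: bij_betw_def inj_on_def)
  then have "(\<integral>\<^sup>+\<xi>. ennreal (\<Prod>k\<leftarrow>\<xi>. w k) \<partial>count_space (configs (Suc m)))
      = (\<integral>\<^sup>+z. ennreal (\<Prod>k\<leftarrow>case_prod Cons z. w k) \<partial>count_space (UNIV \<times> configs m))"
    by (rule nn_integral_bij_count_space[symmetric])
  also have "\<dots> = (\<integral>\<^sup>+z. ennreal (\<Prod>k\<leftarrow>case_prod Cons z. w k) * indicator (UNIV \<times> configs m) z
      \<partial>count_space UNIV)"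
    using nn_integral_count_space_indicator[of "UNIV \<times> configs m"] by simp
  also have "\<dots> = (\<integral>\<^sup>+x. \<integral>\<^sup>+\<xi>. ennreal (w x) * (ennreal (\<Prod>k\<leftarrow>\<xi>. w k) * indicator (configs m) \<xi>)
      \<partial>count_space UNIV \<partial>count_space UNIV)"
    unfolding nn_integral_fst_count_space[symmetric]
    by (intro nn_integral_cong)
       (auto simp: indicator_def ennreal_mult w prod_list_map_nonneg)
  also have "\<dots> = (\<integral>\<^sup>+x. ennreal (w x) * ennreal ((\<Sum>n. w n) ^ m) \<partial>count_space UNIV)"
    unfolding Suc.IH[symmetric]
    by (intro nn_integral_cong, subst nn_integral_cmult)
       (simp_all add: nn_integral_count_space_indicator[of "configs m"])
  also have "\<dots> = ennreal (\<Sum>n. w n) * ennreal ((\<Sum>n. w n) ^ m)"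
    using w s by (simp add: nn_integral_multc nn_integral_count_space_nat suminf_ennreal2)
  also have "\<dots> = ennreal ((\<Sum>n. w n) ^ Suc m)"
    using w s by (simp add: ennreal_mult suminf_nonneg)
  finally show ?case .
qed

lemma prob_space_grand_canonical:
  assumes "\<And>n. f n > 0" "summable (\<lambda>n. \<gamma> ^ n * f n)" "0 \<le> \<phi>" "\<phi> \<le> \<gamma>"
  shows "prob_space (grand_canonical f \<phi> m)"
proof -
  have s: "summable (\<lambda>n. \<phi> ^ n * f n)" by (rule summable_le_radius[OF assms])
  have Z: "partition_function f \<phi> > 0"
    by (rule partition_function_pos[OF assms(1) s assms(3)])
  have nn: "\<And>n. \<phi> ^ n * f n \<ge> 0" using assms by (simp add: less_imp_le)
  have "emeasure (grand_canonical f \<phi> m) (space (grand_canonical f \<phi> m))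
      = (\<integral>\<^sup>+\<xi>. ennreal ((\<Prod>k\<leftarrow>\<xi>. \<phi> ^ k * f k) / partition_function f \<phi> ^ m)
          \<partial>count_space (configs m))"
    unfolding grand_canonical_def point_measure_def
    by (auto simp: emeasure_density intro!: nn_integral_cong)
  also have "\<dots> = (\<integral>\<^sup>+\<xi>. ennreal (\<Prod>k\<leftarrow>\<xi>. \<phi> ^ k * f k) / ennreal (partition_function f \<phi> ^ m)
          \<partial>count_space (configs m))"
    using Z nn by (intro nn_integral_cong) (simp add: divide_ennreal prod_list_map_nonneg)
  also have "\<dots> = ennreal (partition_function f \<phi> ^ m) / ennreal (partition_function f \<phi> ^ m)"
    by (simp add: nn_integral_divide nn_integral_configs[OF nn s] partition_function_def)
  also have "\<dots> = 1" using Z by (simp add: divide_ennreal)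
  finally show ?thesis by (rule prob_spaceI)
qed

lemma finite_configs_total: "finite {\<xi> \<in> configs m. sum_list \<xi> = n}"
proof (rule finite_subset)
  show "{\<xi> \<in> configs m. sum_list \<xi> = n} \<subseteq> {\<xi>. set \<xi> \<subseteq> {..n} \<and> length \<xi> = m}"
    by (auto simp: configs_def member_le_sum_list)
qed (simp add: finite_lists_length_eq)

lemma configs_total_nonempty:
  assumes "m \<ge> 1" shows "{\<xi> \<in> configs m. sum_list \<xi> = n} \<noteq> {}"
proof -
  have "n # replicate (m - 1) 0 \<in> {\<xi> \<in> configs m. sum_list \<xi> = n}"
    using assms by (auto simp: configs_def)
  then show ?thesis by blast
qed

lemma canonical_normaliser_pos:
  fixes f :: "nat \<Rightarrow> real"
  assumes "\<And>n. f n > 0" "m \<ge> 1"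
  shows "(\<Sum>\<eta> | \<eta> \<in> configs m \<and> sum_list \<eta> = n. \<Prod>k\<leftarrow>\<eta>. f k) > 0"
  using assms configs_total_nonempty[of m n] finite_configs_total[of m n]
  by (intro sum_pos) (auto intro: prod_list_map_pos)

lemma prod_list_power_mult:
  "(\<Prod>k\<leftarrow>\<xi>. (\<phi> :: real) ^ k * f k) = \<phi> ^ sum_list \<xi> * (\<Prod>k\<leftarrow>\<xi>. f k)"
  by (induction \<xi>) (auto simp: power_add)

lemma canonical_eq_conditional:
  fixes f :: "nat \<Rightarrow> real"
  assumes f: "\<And>n. f n > 0" and s: "summable (\<lambda>n. \<gamma> ^ n * f n)"
    and \<phi>: "0 < \<phi>" "\<phi> \<le> \<gamma>" and m: "m \<ge> 1"
  shows "canonical f m n =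
           uniform_measure (grand_canonical f \<phi> m) {\<xi> \<in> configs m. sum_list \<xi> = n}"
proof -
  define A where "A = {\<xi> \<in> configs m. sum_list \<xi> = n}"
  define S where "S = (\<Sum>\<eta> | \<eta> \<in> configs m \<and> sum_list \<eta> = n. \<Prod>k\<leftarrow>\<eta>. f k)"
  define Z where "Z = partition_function f \<phi>"
  have Z: "Z > 0"
    unfolding Z_def using \<phi>
    by (intro partition_function_pos f summable_le_radius[OF f s]) auto
  have S: "S > 0" unfolding S_def by (rule canonical_normaliser_pos[OF f m])
  have nn: "\<And>\<xi>. (\<Prod>k\<leftarrow>\<xi>. f k) \<ge> 0" using f by (simp add: prod_list_map_nonneg less_imp_le)
  have A: "finite A" "A \<subseteq> configs m" using finite_configs_total by (auto simp: A_def)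
  have "emeasure (grand_canonical f \<phi> m) A
      = (\<Sum>\<xi>\<in>A. ennreal ((\<Prod>k\<leftarrow>\<xi>. \<phi> ^ k * f k) / Z ^ m))"
    unfolding grand_canonical_def Z_def[symmetric]
    using A by (subst emeasure_point_measure_finite2) auto
  also have "\<dots> = (\<Sum>\<xi>\<in>A. ennreal (\<phi> ^ n / Z ^ m * (\<Prod>k\<leftarrow>\<xi>. f k)))"
    by (intro sum.cong) (auto simp: A_def prod_list_power_mult)
  also have "\<dots> = ennreal (\<phi> ^ n / Z ^ m * S)"
    using nn \<phi> Z by (subst sum_ennreal) (auto simp: S_def A_def sum_distrib_left)
  finally have em: "emeasure (grand_canonical f \<phi> m) A = ennreal (\<phi> ^ n / Z ^ m * S)" .
  have "uniform_measure (grand_canonical f \<phi> m) A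
      = density (count_space (configs m)) (\<lambda>\<xi>. ennreal ((\<Prod>k\<leftarrow>\<xi>. \<phi> ^ k * f k) / Z ^ m)
           * (indicator A \<xi> / ennreal (\<phi> ^ n / Z ^ m * S)))"
    unfolding uniform_measure_def em
    unfolding grand_canonical_def point_measure_def Z_def[symmetric]
    by (subst density_density_eq) auto
  also have "\<dots> = density (count_space (configs m))
      (\<lambda>\<xi>. if sum_list \<xi> = n then ennreal ((\<Prod>k\<leftarrow>\<xi>. f k) / S) else 0)"
  proof (intro density_cong)
    show "AE \<xi> in count_space (configs m).
        ennreal ((\<Prod>k\<leftarrow>\<xi>. \<phi> ^ k * f k) / Z ^ m) * (indicator A \<xi> / ennreal (\<phi> ^ n / Z ^ m * S))
        = (if sum_list \<xi> = n then ennreal ((\<Prod>k\<leftarrow>\<xi>. f k) / S) else 0)"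
    proof (rule AE_I2)
      fix \<xi> assume "\<xi> \<in> space (count_space (configs m))"
      then have \<xi>: "\<xi> \<in> configs m" by simp
      show "ennreal ((\<Prod>k\<leftarrow>\<xi>. \<phi> ^ k * f k) / Z ^ m) * (indicator A \<xi> / ennreal (\<phi> ^ n / Z ^ m * S))
        = (if sum_list \<xi> = n then ennreal ((\<Prod>k\<leftarrow>\<xi>. f k) / S) else 0)"
      proof (cases "sum_list \<xi> = n")
        case True
        have "indicator A \<xi> / ennreal (\<phi> ^ n / Z ^ m * S) = ennreal (1 / (\<phi> ^ n / Z ^ m * S))"
          using True \<xi> \<phi> Z S divide_ennreal[of 1 "\<phi> ^ n / Z ^ m * S"] by (simp add: A_def)
        moreover have "(\<Prod>k\<leftarrow>\<xi>. \<phi> ^ k * f k) / Z ^ m * (1 / (\<phi> ^ n / Z ^ m * S)) = (\<Prod>k\<leftarrow>\<xi>. f k) / S"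
          unfolding prod_list_power_mult using True \<phi> Z S by (simp add: field_simps)
        moreover have "(\<Prod>k\<leftarrow>\<xi>. \<phi> ^ k * f k) / Z ^ m \<ge> 0"
          unfolding prod_list_power_mult using \<phi> Z nn by simp
        moreover have "1 / (\<phi> ^ n / Z ^ m * S) \<ge> 0" using \<phi> Z S by simp
        ultimately show ?thesis using True by (metis ennreal_mult)
      qed (simp add: A_def)
    qed
  qed auto
  finally show ?thesis
    unfolding canonical_def point_measure_def S_def A_def by simp
qed

lemma prob_space_canonical:
  fixes f :: "nat \<Rightarrow> real"
  assumes f: "\<And>n. f n > 0" and m: "m \<ge> 1"
  shows "prob_space (canonical f m n)"
proof (rule prob_spaceI)
  define A where "A = {\<xi> \<in> configs m. sum_list \<xi> = n}"
  define S where "S = (\<Sum>\<eta> | \<eta> \<in> configs m \<and> sum_list \<eta> = n. \<Prod>k\<leftarrow>\<eta>. f k)"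
  have S: "S > 0" unfolding S_def by (rule canonical_normaliser_pos[OF f m])
  have nn: "\<And>\<xi>. (\<Prod>k\<leftarrow>\<xi>. f k) \<ge> 0" using f by (simp add: prod_list_map_nonneg less_imp_le)
  have "emeasure (canonical f m n) (space (canonical f m n))
      = (\<integral>\<^sup>+\<xi>. (if sum_list \<xi> = n then ennreal ((\<Prod>k\<leftarrow>\<xi>. f k) / S) else 0)
           \<partial>count_space (configs m))"
    unfolding canonical_def point_measure_def S_def[symmetric]
    by (auto simp: emeasure_density intro!: nn_integral_cong)
  also have "\<dots> = (\<Sum>\<xi>\<in>A. if sum_list \<xi> = n then ennreal ((\<Prod>k\<leftarrow>\<xi>. f k) / S) else 0)"
    by (intro nn_integral_count_space'[where A = A])
       (auto simp: A_def finite_configs_total)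
  also have "\<dots> = (\<Sum>\<xi>\<in>A. ennreal ((\<Prod>k\<leftarrow>\<xi>. f k) / S))"
    by (intro sum.cong) (auto simp: A_def)
  also have "\<dots> = ennreal ((\<Sum>\<xi>\<in>A. \<Prod>k\<leftarrow>\<xi>. f k) / S)"
    using nn S by (subst sum_ennreal) (auto simp: sum_divide_distrib)
  also have "(\<Sum>\<xi>\<in>A. \<Prod>k\<leftarrow>\<xi>. f k) = S" by (simp add: S_def A_def)
  finally show "emeasure (canonical f m n) (space (canonical f m n)) = 1" using S by simp
qed

lemma sort_in_ordered_configs: "\<xi> \<in> configs m \<Longrightarrow> sort \<xi> \<in> ordered_configs m"
  by (simp add: configs_def ordered_configs_def)

lemma cut_sort_in_ordered_configs:
  "\<xi> \<in> configs (Suc k) \<Longrightarrow> butlast (sort \<xi>) \<in> ordered_configs k"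
  by (simp add: configs_def ordered_configs_def sorted_butlast)

lemma prob_space_ordered_grand_canonical:
  assumes "\<And>n. f n > 0" "summable (\<lambda>n. \<gamma> ^ n * f n)" "0 \<le> \<phi>" "\<phi> \<le> \<gamma>"
  shows "prob_space (ordered_grand_canonical f \<phi> m)"
  unfolding ordered_grand_canonical_def
  by (rule prob_space.prob_space_distr[OF prob_space_grand_canonical[OF assms]])
     (auto simp: grand_canonical_def sort_in_ordered_configs)

lemma prob_space_cut_canonical:
  assumes "\<And>n. f n > 0"
  shows "prob_space (cut_canonical f k n)"
  unfolding cut_canonical_def
  by (rule prob_space.prob_space_distr[OF prob_space_canonical[OF assms]])
     (auto simp: canonical_def cut_sort_in_ordered_configs)

end

theory Submission
  imports Defs
begin

text \<open>Put \<open>w n = \<gamma> ^ n * f n\<close>. Since the canonical weights are symmetric, a sum over configurations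
  of total \<open>n\<close> may be restricted to those whose last coordinate is maximal, at the price of
  the factor \<open>(k + 1)\<close> divided by the multiplicity of the maximum. Such a configuration is
  \<open>\<eta> @ [n - \<bar>\<eta>\<bar>]\<close>, and its weight divided by \<open>w n\<close> tends to the weight of \<open>\<eta>\<close> because
  \<open>w (n - j) / w n\<close> tends to \<open>1\<close> for each fixed \<open>j\<close>. The convergence is dominated: a maximal coordinate
  is at least \<open>n / (k + 1)\<close>, so hypotheses (ii) and (iii) give \<open>w (n - \<bar>\<eta>\<bar>) \<le> C (k + 1) * w n\<close>.\<close>

section \<open>Finite sums over configurations\<close>

lemma finite_total_le: "finite {\<eta> \<in> configs k. sum_list \<eta> \<le> n}"
proof (rule finite_subset)
  show "{\<eta> \<in> configs k. sum_list \<eta> \<le> n} \<subseteq> (\<Union>j\<le>n. {\<eta> \<in> configs k. sum_list \<eta> = j})" by auto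
qed (auto intro: finite_configs_total)

text \<open>Lets sums over finite sets that vary with \<open>n\<close> be read as integrals over one
  fixed counting space, where dominated convergence applies.\<close>

lemma integral_count_space_eq_sum:
  fixes F :: "'a \<Rightarrow> real"
  assumes "finite A" "A \<subseteq> X" "\<And>x. x \<in> X \<Longrightarrow> x \<notin> A \<Longrightarrow> F x = 0"
  shows "(\<integral>x. F x \<partial>count_space X) = (\<Sum>x\<in>A. F x)"
proof -
  have "finite {x \<in> X. F x \<noteq> 0}" using assms by (auto intro: finite_subset[of _ A])
  then show ?thesis
    using assms by (subst lebesgue_integral_count_space_finite_support) (auto intro!: sum.mono_neutral_left)
qed

section \<open>Symmetric sums and the position of the maximum\<close>

lemma card_index_eq_count_list: "card {i. i < length xs \<and> xs ! i = x} = count_list xs x"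
  by (simp add: count_list_eq_length_filter length_filter_conv_card eq_commute)

text \<open>Each value \<open>F \<xi>\<close> is shared equally among the positions where
  \<open>\<xi>\<close> attains its maximum. By symmetry every position collects the same total, so
  all \<open>Suc k\<close> of them may be replaced by the last one. The \<open>Suc\<close> in the
  denominator counts the last coordinate itself, next to its repetitions in
  \<open>\<eta>\<close>.\<close>

lemma sum_configs_last_max:
  fixes F :: "nat list \<Rightarrow> real"
  assumes sym: "\<And>xs ys. mset xs = mset ys \<Longrightarrow> F xs = F ys"
  shows "(\<Sum>\<xi> | \<xi> \<in> configs (Suc k) \<and> sum_list \<xi> = n. F \<xi>) =
    real (Suc k) * (\<Sum>\<eta> | \<eta> \<in> configs k \<and> sum_list \<eta> \<le> n \<and> (\<forall>x\<in>set \<eta>. x \<le> n - sum_list \<eta>).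
      F (\<eta> @ [n - sum_list \<eta>]) / real (Suc (count_list \<eta> (n - sum_list \<eta>))))"
proof -
  define A where "A = {\<xi>. \<xi> \<in> configs (Suc k) \<and> sum_list \<xi> = n}"
  have finA: "finite A" unfolding A_def by (rule finite_configs_total)
  \<comment> \<open>The share of position \<open>i\<close>; it is zero unless that position carries
    the maximum.\<close>
  define \<phi> where "\<phi> \<xi> i = (if \<xi> ! i = Max (set \<xi>) then F \<xi> / real (count_list \<xi> (Max (set \<xi>))) else 0)"
    for \<xi> :: "nat list" and i
  have split: "F \<xi> = (\<Sum>i<Suc k. \<phi> \<xi> i)" if "\<xi> \<in> A" for \<xi>
  proof -
    have len: "length \<xi> = Suc k" using that by (simp add: A_def configs_def)
    then have "Max (set \<xi>) \<in> set \<xi>" by (intro Max_in) auto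
    then have c: "count_list \<xi> (Max (set \<xi>)) \<noteq> 0" by (simp add: count_list_0_iff)
    have "(\<Sum>i<Suc k. \<phi> \<xi> i) = real (card {i. i < length \<xi> \<and> \<xi> ! i = Max (set \<xi>)})
        * (F \<xi> / real (count_list \<xi> (Max (set \<xi>))))"
      unfolding \<phi>_def len
      by (subst sum.If_cases) (auto intro!: arg_cong[of _ _ card])
    then show ?thesis using c by (simp add: card_index_eq_count_list)
  qed
  have swap: "(\<Sum>\<xi>\<in>A. \<phi> \<xi> i) = (\<Sum>\<xi>\<in>A. \<phi> \<xi> k)" if i: "i < Suc k" for i
  proof -
    \<comment> \<open>Exchanging positions \<open>i\<close> and \<open>k\<close> is an involution of
      \<open>A\<close> that takes the share of \<open>i\<close> to the share of
      \<open>k\<close>.\<close>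
    define s where "s \<xi> = \<xi>[i := \<xi> ! k, k := \<xi> ! i]" for \<xi> :: "nat list"
    have len: "length \<xi> = Suc k" if "\<xi> \<in> A" for \<xi> using that by (simp add: A_def configs_def)
    have ms: "mset (s \<xi>) = mset \<xi>" if "\<xi> \<in> A" for \<xi>
      unfolding s_def using len[OF that] i by (intro mset_swap) auto
    have sA: "s \<xi> \<in> A" if "\<xi> \<in> A" for \<xi>
      using that ms[OF that] by (auto simp: A_def configs_def s_def simp flip: sum_mset_sum_list)
    have inv: "s (s \<xi>) = \<xi>" if "\<xi> \<in> A" for \<xi>
      using len[OF that] i by (auto simp: s_def list_eq_iff_nth_eq nth_list_update)
    have \<phi>s: "\<phi> (s \<xi>) k = \<phi> \<xi> i" if "\<xi> \<in> A" for \<xi>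
    proof -
      have "s \<xi> ! k = \<xi> ! i" using len[OF that] i by (simp add: s_def)
      moreover have "set (s \<xi>) = set \<xi>" using ms[OF that] by (rule mset_eq_setD)
      moreover have "count_list (s \<xi>) x = count_list \<xi> x" for x
        using ms[OF that] by (metis count_mset)
      ultimately show ?thesis using sym[OF ms[OF that]] by (simp add: \<phi>_def)
    qed
    show ?thesis
      by (rule sum.reindex_bij_witness[where i = s and j = s]) (auto simp: sA inv \<phi>s)
  qed
  have "(\<Sum>\<xi>\<in>A. F \<xi>) = (\<Sum>i<Suc k. \<Sum>\<xi>\<in>A. \<phi> \<xi> i)"
    by (subst sum.swap) (rule sum.cong[OF refl split])
  also have "\<dots> = (\<Sum>i<Suc k. \<Sum>\<xi>\<in>A. \<phi> \<xi> k)"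
    by (rule sum.cong[OF refl], rule swap) simp
  also have "\<dots> = real (Suc k) * (\<Sum>\<xi>\<in>A. \<phi> \<xi> k)" by simp
  also have "(\<Sum>\<xi>\<in>A. \<phi> \<xi> k) =
      (\<Sum>\<xi>\<in>{\<xi>\<in>A. \<xi> ! k = Max (set \<xi>)}. F \<xi> / real (count_list \<xi> (Max (set \<xi>))))"
    unfolding \<phi>_def by (rule sum.inter_filter[OF finA, symmetric])
  also have "\<dots> = (\<Sum>\<eta> | \<eta> \<in> configs k \<and> sum_list \<eta> \<le> n \<and> (\<forall>x\<in>set \<eta>. x \<le> n - sum_list \<eta>).
      F (\<eta> @ [n - sum_list \<eta>]) / real (Suc (count_list \<eta> (n - sum_list \<eta>))))"
  \<comment> \<open>The total recovers the deleted last coordinate;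
    \<open>sum_list \<eta> \<le> n\<close> keeps the truncated subtraction exact.\<close>
  proof (rule sum.reindex_bij_witness[where j = butlast and i = "\<lambda>\<eta>. \<eta> @ [n - sum_list \<eta>]"])
    fix \<xi> assume "\<xi> \<in> {\<xi>\<in>A. \<xi> ! k = Max (set \<xi>)}"
    then have len: "length \<xi> = Suc k" and tot: "sum_list \<xi> = n" and mx: "\<xi> ! k = Max (set \<xi>)"
      by (auto simp: A_def configs_def)
    obtain \<eta> x where \<xi>: "\<xi> = \<eta> @ [x]" using len by (cases \<xi> rule: rev_cases) auto
    have k: "length \<eta> = k" using len \<xi> by simp
    then have x: "x = Max (set \<xi>)" using mx \<xi> by (metis nth_append_length)
    have n: "n = sum_list \<eta> + x" using tot \<xi> by simp
    have le: "\<forall>y\<in>set \<eta>. y \<le> x" using x \<xi> by (metis List.finite_set Max_ge UnCI set_append)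
    show "butlast \<xi> @ [n - sum_list (butlast \<xi>)] = \<xi>" using \<xi> n by simp
    show "butlast \<xi> \<in> {\<eta>. \<eta> \<in> configs k \<and> sum_list \<eta> \<le> n \<and> (\<forall>x\<in>set \<eta>. x \<le> n - sum_list \<eta>)}"
      using \<xi> k n le by (simp add: configs_def)
    show "F (butlast \<xi> @ [n - sum_list (butlast \<xi>)]) /
          real (Suc (count_list (butlast \<xi>) (n - sum_list (butlast \<xi>))))
        = F \<xi> / real (count_list \<xi> (Max (set \<xi>)))"
      unfolding x[symmetric] using \<xi> n by simp
  next
    fix \<eta> assume \<eta>: "\<eta> \<in> {\<eta>. \<eta> \<in> configs k \<and> sum_list \<eta> \<le> n \<and> (\<forall>x\<in>set \<eta>. x \<le> n - sum_list \<eta>)}"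
    show "butlast (\<eta> @ [n - sum_list \<eta>]) = \<eta>" by simp
    have "Max (set (\<eta> @ [n - sum_list \<eta>])) = n - sum_list \<eta>"
      using \<eta> by (intro Max_eqI) auto
    moreover have "(\<eta> @ [n - sum_list \<eta>]) ! k = n - sum_list \<eta>"
      using \<eta> by (simp add: configs_def nth_append)
    ultimately show "\<eta> @ [n - sum_list \<eta>] \<in> {\<xi>\<in>A. \<xi> ! k = Max (set \<xi>)}"
      using \<eta> by (simp add: A_def configs_def)
  qed
  finally show ?thesis unfolding A_def .
qed

section \<open>Ratio limits and domination for the weights\<close>

text \<open>The ratio telescopes into \<open>j\<close> consecutive ratios, each tending to 1. The
  induction runs on the shifted form \<open>w n / w (n + j)\<close>, where no truncated subtraction
  occurs.\<close>

lemma tendsto_shift_ratio: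
  fixes w :: "nat \<Rightarrow> real"
  assumes pos: "\<And>n. w n > 0" and lim: "(\<lambda>n. w n / w (Suc n)) \<longlonglongrightarrow> 1"
  shows "(\<lambda>n. w (n - j) / w n) \<longlonglongrightarrow> 1"
proof -
  have "(\<lambda>n. w n / w (n + j)) \<longlonglongrightarrow> 1"
  proof (induction j)
    case 0
    show ?case using pos by (simp add: less_imp_neq[symmetric])
  next
    case (Suc j)
    have "(\<lambda>n. w n / w (n + j) * (w (n + j) / w (Suc (n + j)))) \<longlonglongrightarrow> 1 * 1"
      by (intro tendsto_mult Suc.IH LIMSEQ_ignore_initial_segment[OF lim])
    moreover have "w n / w (n + j) * (w (n + j) / w (Suc (n + j))) = w n / w (n + Suc j)" for n
      using pos[of "n + j"] by simp
    ultimately show ?case by (simp only: mult_1)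
  qed
  then show ?thesis
    by (intro LIMSEQ_offset[of "\<lambda>n. w (n - j) / w n" j]) simp
qed

text \<open>Here \<open>x\<close> plays the maximum of \<open>l\<close> coordinates with total
  \<open>n\<close>. The divisibility hypothesis compares \<open>w x\<close> with
  \<open>w (l * x)\<close>, and monotonicity then passes to \<open>w n\<close>.\<close>

lemma weight_of_max_le:
  fixes w :: "nat \<Rightarrow> real"
  assumes pos: "\<And>n. w n > 0" and anti: "antimono w"
    and C: "\<And>n. l dvd n \<Longrightarrow> w (n div l) \<le> C * w n"
    and l: "l \<ge> 1" and x: "n \<le> l * x"
  shows "w x \<le> C * w n"
proof -
  \<comment> \<open>Every \<open>l\<close> divides 0, so the case \<open>n = 0\<close> already
    forces \<open>C\<close> to be nonnegative.\<close>
  have "w 0 \<le> C * w 0" using C[of 0] by simp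
  then have "C \<ge> 0" using pos[of 0] by (smt (verit) mult_nonneg_nonneg mult_neg_pos)
  have "w x \<le> C * w (l * x)" using C[of "l * x"] l by simp
  also have "\<dots> \<le> C * w n"
    by (rule mult_left_mono[OF antimonoD[OF anti x] \<open>C \<ge> 0\<close>])
  finally show ?thesis .
qed

lemma integrable_configs:
  assumes "\<And>n. (w n :: real) \<ge> 0" "summable w"
  shows "integrable (count_space (configs k)) (\<lambda>\<eta>. \<Prod>x\<leftarrow>\<eta>. w x)"
  by (rule integrableI_nonneg)
     (use assms in \<open>auto simp: nn_integral_configs prod_list_map_nonneg\<close>)

section \<open>Dominated convergence for the cut configurations\<close>

text \<open>Stated for a general bounded \<open>h\<close> so that it serves twice: with a test
  function it gives the numerator of the canonical expectation, and with \<open>h = 1\<close> its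
  normaliser.\<close>

lemma tendsto_symmetric_sum_over_configs:
  fixes w :: "nat \<Rightarrow> real" and h :: "nat list \<Rightarrow> real"
  assumes pos: "\<And>n. w n > 0" and anti: "antimono w" and summ: "summable w"
    and lim: "(\<lambda>n. w n / w (Suc n)) \<longlonglongrightarrow> 1"
    and C: "\<And>n. Suc k dvd n \<Longrightarrow> w (n div Suc k) \<le> C * w n"
    and B: "\<And>\<eta>. \<eta> \<in> ordered_configs k \<Longrightarrow> \<bar>h \<eta>\<bar> \<le> B"
  shows "(\<lambda>n. (\<Sum>\<xi> | \<xi> \<in> configs (Suc k) \<and> sum_list \<xi> = n. (\<Prod>x\<leftarrow>\<xi>. w x) * h (butlast (sort \<xi>))) / w n)
    \<longlonglongrightarrow> real (Suc k) * (\<integral>\<eta>. (\<Prod>x\<leftarrow>\<eta>. w x) * h (sort \<eta>) \<partial>count_space (configs k))"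
proof -
  define D where "D n = {\<eta>. \<eta> \<in> configs k \<and> sum_list \<eta> \<le> n \<and> (\<forall>x\<in>set \<eta>. x \<le> n - sum_list \<eta>)}" for n
  \<comment> \<open>Extension by zero outside \<open>D n\<close> gives all \<open>n\<close> the same
    domain of integration.\<close>
  define a where "a n \<eta> = (if \<eta> \<in> D n then (\<Prod>x\<leftarrow>\<eta>. w x) * h (sort \<eta>)
      * (w (n - sum_list \<eta>) / w n) / real (Suc (count_list \<eta> (n - sum_list \<eta>))) else 0)" for n \<eta>
  have W: "(\<Prod>x\<leftarrow>\<eta>. w x) > 0" for \<eta> by (rule prod_list_map_pos[OF pos])
  have finD: "finite (D n)" for n
    by (rule finite_subset[OF _ finite_total_le[of k n]]) (auto simp: D_def)
  have C0: "C \<ge> 0"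
    using C[of 0] pos[of 0] by (smt (verit) mult_neg_pos div_0 dvd_0_right)
  have hB: "\<bar>h (sort \<eta>)\<bar> \<le> B" if "\<eta> \<in> configs k" for \<eta>
    by (rule B[OF sort_in_ordered_configs[OF that]])
  have eq: "(\<Sum>\<xi> | \<xi> \<in> configs (Suc k) \<and> sum_list \<xi> = n. (\<Prod>x\<leftarrow>\<xi>. w x) * h (butlast (sort \<xi>))) / w n
      = real (Suc k) * (\<integral>\<eta>. a n \<eta> \<partial>count_space (configs k))" for n
  proof -
    \<comment> \<open>A last entry that dominates the others stays last after sorting, so the cut
      removes exactly that entry.\<close>
    have srt: "butlast (sort (\<eta> @ [x])) = sort \<eta>" if "\<forall>y\<in>set \<eta>. y \<le> x" for \<eta> and x :: nat
    proof -
      have "sort (\<eta> @ [x]) = sort \<eta> @ [x]"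
        using that by (intro properties_for_sort) (auto simp: sorted_append)
      then show ?thesis by simp
    qed
    have prod: "(\<Prod>x\<leftarrow>xs. w x) * h (butlast (sort xs)) = (\<Prod>x\<leftarrow>ys. w x) * h (butlast (sort ys))"
      if "mset xs = mset ys" for xs ys
    proof -
      have "sort xs = sort ys" using that by (intro properties_for_sort) auto
      moreover have "(\<Prod>x\<leftarrow>xs. w x) = (\<Prod>x\<leftarrow>ys. w x)"
        using that by (metis mset_map prod_mset_prod_list)
      ultimately show ?thesis by simp
    qed
    have "(\<Sum>\<xi> | \<xi> \<in> configs (Suc k) \<and> sum_list \<xi> = n. (\<Prod>x\<leftarrow>\<xi>. w x) * h (butlast (sort \<xi>))) / w n
      = real (Suc k) * (\<Sum>\<eta>\<in>D n. (\<Prod>x\<leftarrow>\<eta> @ [n - sum_list \<eta>]. w x)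
          * h (butlast (sort (\<eta> @ [n - sum_list \<eta>])))
          / real (Suc (count_list \<eta> (n - sum_list \<eta>))) / w n)"
      by (subst sum_configs_last_max[OF prod], assumption)
         (simp only: D_def sum_divide_distrib[symmetric] times_divide_eq_right)
    also have "(\<Sum>\<eta>\<in>D n. (\<Prod>x\<leftarrow>\<eta> @ [n - sum_list \<eta>]. w x)
          * h (butlast (sort (\<eta> @ [n - sum_list \<eta>])))
          / real (Suc (count_list \<eta> (n - sum_list \<eta>))) / w n) = (\<Sum>\<eta>\<in>D n. a n \<eta>)"
      by (intro sum.cong refl) (subst srt, auto simp: a_def D_def mult_ac)
    also have "\<dots> = (\<integral>\<eta>. a n \<eta> \<partial>count_space (configs k))"
      by (rule integral_count_space_eq_sum[OF finD, symmetric]) (auto simp: a_def D_def)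
    finally show ?thesis .
  qed
  have "(\<lambda>n. \<integral>\<eta>. a n \<eta> \<partial>count_space (configs k)) \<longlonglongrightarrow>
      (\<integral>\<eta>. (\<Prod>x\<leftarrow>\<eta>. w x) * h (sort \<eta>) \<partial>count_space (configs k))"
  \<comment> \<open>\<open>B\<close> bounds \<open>h\<close> and \<open>C\<close> bounds the ratio
    \<open>w (n - sum_list \<eta>) / w n\<close> on \<open>D n\<close>; the product weights are
    integrable because \<open>w\<close> is summable.\<close>
  proof (rule integral_dominated_convergence[where w = "\<lambda>\<eta>. (\<Prod>x\<leftarrow>\<eta>. w x) * (B * C)"])
    show "integrable (count_space (configs k)) (\<lambda>\<eta>. (\<Prod>x\<leftarrow>\<eta>. w x) * (B * C))"
      by (intro integrable_mult_left integrable_configs summ) (simp add: pos less_imp_le)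
    show "AE \<eta> in count_space (configs k).
        (\<lambda>n. a n \<eta>) \<longlonglongrightarrow> (\<Prod>x\<leftarrow>\<eta>. w x) * h (sort \<eta>)"
    proof (rule AE_I2)
      fix \<eta> assume "\<eta> \<in> space (count_space (configs k))"
      then have \<eta>: "\<eta> \<in> configs k" by simp
      have "\<forall>\<^sub>F n in sequentially. (\<Prod>x\<leftarrow>\<eta>. w x) * h (sort \<eta>) * (w (n - sum_list \<eta>) / w n) = a n \<eta>"
        \<comment> \<open>Beyond twice the total of \<open>\<eta>\<close>, the remainder
          \<open>n - sum_list \<eta>\<close> exceeds every entry of \<open>\<eta>\<close>. The
          maximum is then unique and the multiplicity factor equals 1.\<close>
        using eventually_gt_at_top[of "2 * sum_list \<eta>"]
      proof eventually_elim
        case (elim n)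
        have lt: "x < n - sum_list \<eta>" if "x \<in> set \<eta>" for x
          using member_le_sum_list[OF that] elim by linarith
        then have "\<eta> \<in> D n" using \<eta> elim by (fastforce simp: D_def)
        moreover have "count_list \<eta> (n - sum_list \<eta>) = 0"
          using lt by (auto simp: count_list_0_iff)
        ultimately show ?case by (simp add: a_def)
      qed
      moreover have "(\<lambda>n. (\<Prod>x\<leftarrow>\<eta>. w x) * h (sort \<eta>) * (w (n - sum_list \<eta>) / w n))
          \<longlonglongrightarrow> (\<Prod>x\<leftarrow>\<eta>. w x) * h (sort \<eta>) * 1"
        by (intro tendsto_intros tendsto_shift_ratio[OF pos lim])
      ultimately show "(\<lambda>n. a n \<eta>) \<longlonglongrightarrow> (\<Prod>x\<leftarrow>\<eta>. w x) * h (sort \<eta>)"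
        using Lim_transform_eventually by fastforce
    qed
    show "AE \<eta> in count_space (configs k). norm (a n \<eta>) \<le> (\<Prod>x\<leftarrow>\<eta>. w x) * (B * C)" for n
    proof (rule AE_I2)
      fix \<eta> assume "\<eta> \<in> space (count_space (configs k))"
      then have \<eta>: "\<eta> \<in> configs k" by simp
      have B0: "B \<ge> 0" using hB[OF \<eta>] by linarith
      show "norm (a n \<eta>) \<le> (\<Prod>x\<leftarrow>\<eta>. w x) * (B * C)"
      proof (cases "\<eta> \<in> D n")
        case True
        define y where "y = n - sum_list \<eta>"
        \<comment> \<open>Each of the \<open>k\<close> entries is at most \<open>y\<close>, and the
          last coordinate is \<open>y\<close> itself; hence
          \<open>n \<le> Suc k * y\<close>.\<close>
        have "sum_list \<eta> \<le> k * y"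
          using sum_list_mono[of \<eta> "\<lambda>x. x" "\<lambda>_. y"] True
          by (auto simp: D_def configs_def y_def sum_list_triv)
        then have "n \<le> Suc k * y" using True by (simp add: D_def y_def)
        then have "w y \<le> C * w n" by (intro weight_of_max_le[OF pos anti C]) auto
        then have r: "w y / w n \<le> C" using pos[of n] by (simp add: field_simps)
        have r0: "0 \<le> w y / w n" using pos[of n] pos[of y] by simp
        have "norm (a n \<eta>) = (\<Prod>x\<leftarrow>\<eta>. w x) * (\<bar>h (sort \<eta>)\<bar> * (w y / w n))
            / real (Suc (count_list \<eta> y))"
          using True W[of \<eta>] pos[of n] pos[of y] by (simp add: a_def y_def[symmetric] abs_mult)
        also have "\<dots> \<le> (\<Prod>x\<leftarrow>\<eta>. w x) * (\<bar>h (sort \<eta>)\<bar> * (w y / w n)) / 1"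
          using W[of \<eta>] r0 by (intro divide_left_mono mult_nonneg_nonneg) auto
        also have "\<dots> \<le> (\<Prod>x\<leftarrow>\<eta>. w x) * (B * C)"
          using W[of \<eta>] r r0 hB[OF \<eta>] B0 by (simp only: div_by_1) (intro mult_left_mono mult_mono, auto)
        finally show ?thesis .
      qed (use W[of \<eta>] B0 C0 in \<open>simp add: a_def\<close>)
    qed
  qed auto
  then show ?thesis unfolding eq by (rule tendsto_mult_left)
qed

section \<open>Expectations under the two induced measures\<close>

lemma integral_ordered_grand_canonical:
  fixes g :: "nat list \<Rightarrow> real"
  assumes f: "\<And>n. f n > 0" and s: "summable (\<lambda>n. \<phi> ^ n * f n)" and "0 \<le> \<phi>"
  shows "integral\<^sup>L (ordered_grand_canonical f \<phi> k) g =
    (\<integral>\<eta>. (\<Prod>x\<leftarrow>\<eta>. \<phi> ^ x * f x) * g (sort \<eta>) \<partial>count_space (configs k)) / partition_function f \<phi> ^ k"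
proof -
  have Z: "partition_function f \<phi> > 0" by (rule partition_function_pos[OF assms])
  have nn: "(\<Prod>x\<leftarrow>\<eta>. \<phi> ^ x * f x) \<ge> 0" for \<eta>
    using assms by (simp add: prod_list_map_nonneg less_imp_le)
  have "integral\<^sup>L (ordered_grand_canonical f \<phi> k) g = (\<integral>\<eta>. g (sort \<eta>) \<partial>grand_canonical f \<phi> k)"
    unfolding ordered_grand_canonical_def
    by (rule integral_distr) (auto simp: grand_canonical_def sort_in_ordered_configs)
  also have "\<dots> = (\<integral>\<eta>. (\<Prod>x\<leftarrow>\<eta>. \<phi> ^ x * f x) / partition_function f \<phi> ^ k * g (sort \<eta>)
      \<partial>count_space (configs k))"
    unfolding grand_canonical_def point_measure_def
    using nn Z by (subst integral_density) auto
  finally show ?thesis by simp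
qed

lemma integral_cut_canonical:
  fixes g :: "nat list \<Rightarrow> real"
  assumes f: "\<And>n. f n > 0"
  shows "integral\<^sup>L (cut_canonical f k n) g =
    (\<Sum>\<xi> | \<xi> \<in> configs (Suc k) \<and> sum_list \<xi> = n. (\<Prod>x\<leftarrow>\<xi>. f x) * g (butlast (sort \<xi>))) /
    (\<Sum>\<xi> | \<xi> \<in> configs (Suc k) \<and> sum_list \<xi> = n. \<Prod>x\<leftarrow>\<xi>. f x)"
proof -
  define A where "A = {\<xi>. \<xi> \<in> configs (Suc k) \<and> sum_list \<xi> = n}"
  define S where "S = (\<Sum>\<xi>\<in>A. \<Prod>x\<leftarrow>\<xi>. f x)"
  have finA: "finite A" unfolding A_def by (rule finite_configs_total)
  have S: "S > 0" unfolding S_def A_def by (rule canonical_normaliser_pos[OF f]) simp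
  have nn: "(\<Prod>x\<leftarrow>\<xi>. f x) \<ge> 0" for \<xi> using f by (simp add: prod_list_map_nonneg less_imp_le)
  have "integral\<^sup>L (cut_canonical f k n) g = (\<integral>\<xi>. g (butlast (sort \<xi>)) \<partial>canonical f (Suc k) n)"
    unfolding cut_canonical_def
    by (subst integral_distr) (auto simp: canonical_def cut_sort_in_ordered_configs)
  \<comment> \<open>Moving the case distinction inside \<open>ennreal\<close> gives a real-valued
    density, as \<open>integral_density\<close> requires.\<close>
  also have "canonical f (Suc k) n =
      density (count_space (configs (Suc k))) (\<lambda>\<xi>. ennreal (if \<xi> \<in> A then (\<Prod>x\<leftarrow>\<xi>. f x) / S else 0))"
    unfolding canonical_def point_measure_def S_def A_def
    by (intro density_cong) (auto intro!: AE_I2)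
  also have "(\<integral>\<xi>. g (butlast (sort \<xi>)) \<partial>\<dots>) =
      (\<integral>\<xi>. (if \<xi> \<in> A then (\<Prod>x\<leftarrow>\<xi>. f x) / S else 0) * g (butlast (sort \<xi>)) \<partial>count_space (configs (Suc k)))"
    using nn S by (subst integral_density) auto
  also have "\<dots> = (\<Sum>\<xi>\<in>A. (if \<xi> \<in> A then (\<Prod>x\<leftarrow>\<xi>. f x) / S else 0) * g (butlast (sort \<xi>)))"
    by (rule integral_count_space_eq_sum[OF finA]) (auto simp: A_def)
  also have "\<dots> = (\<Sum>\<xi>\<in>A. (\<Prod>x\<leftarrow>\<xi>. f x) * g (butlast (sort \<xi>))) / S"
    by (simp add: sum_divide_distrib)
  finally show ?thesis by (simp add: S_def A_def)
qed

section \<open>Weak convergence as a quotient of two limits\<close>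

theorem theorem1:
  fixes \<gamma> :: real and f :: "nat \<Rightarrow> real" and C :: "nat \<Rightarrow> real" and m :: nat
  assumes "\<gamma> > 0"
    and "\<And>n. f n > 0"
    and "antimono f"
    and "(\<lambda>n. f n / f (Suc n)) \<longlonglongrightarrow> \<gamma>"
    and "summable (\<lambda>n. \<gamma> ^ n * f n)"
    and "antimono (\<lambda>n. \<gamma> ^ n * f n)"
    and "\<And>l n. l \<ge> 1 \<Longrightarrow> l dvd n \<Longrightarrow> \<gamma> ^ (n div l) * f (n div l) \<le> C l * (\<gamma> ^ n * f n)"
    and "m \<ge> 2"
  shows "weakly_converges (discrete_topology (ordered_configs (m - 1)))
           (\<lambda>n. cut_canonical f (m - 1) n) (ordered_grand_canonical f \<gamma> (m - 1))"
  unfolding weakly_converges_def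
proof (intro allI impI)
  fix g :: "nat list \<Rightarrow> real"
  assume g: "continuous_map (discrete_topology (ordered_configs (m - 1))) euclideanreal g \<and>
      bounded (g ` topspace (discrete_topology (ordered_configs (m - 1))))"
  define k where "k = m - 1"
  define w where "w n = \<gamma> ^ n * f n" for n
  define Z where "Z = partition_function f \<gamma>"
  \<comment> \<open>The canonical numerator with \<open>w\<close> in place of
    \<open>f\<close>.\<close>
  define T where "T h n = (\<Sum>\<xi> | \<xi> \<in> configs (Suc k) \<and> sum_list \<xi> = n.
      (\<Prod>x\<leftarrow>\<xi>. w x) * h (butlast (sort \<xi>)))" for h :: "nat list \<Rightarrow> real" and n
  obtain B where B: "\<And>\<eta>. \<eta> \<in> ordered_configs k \<Longrightarrow> \<bar>g \<eta>\<bar> \<le> B"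
    using g by (auto simp: bounded_iff k_def)
  have pos: "w n > 0" for n using assms(1,2) by (simp add: w_def)
  have summ: "summable w" using assms(5) by (simp add: w_def[abs_def])
  have Z: "Z > 0"
    unfolding Z_def using assms(1,2,5) by (intro partition_function_pos) auto
  \<comment> \<open>Dividing by \<open>\<gamma>\<close> turns hypothesis (i) into consecutive ratios
    of \<open>w\<close> tending to 1.\<close>
  have "(\<lambda>n. f n / f (Suc n) / \<gamma>) \<longlonglongrightarrow> \<gamma> / \<gamma>"
    using assms(1,4) by (intro tendsto_divide tendsto_const) auto
  moreover have "f n / f (Suc n) / \<gamma> = w n / w (Suc n)" for n
    using assms(1) by (simp add: w_def field_simps)
  ultimately have lim: "(\<lambda>n. w n / w (Suc n)) \<longlonglongrightarrow> 1" using assms(1) by simp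
  have T: "(\<lambda>n. T h n / w n) \<longlonglongrightarrow>
      real (Suc k) * (\<integral>\<eta>. (\<Prod>x\<leftarrow>\<eta>. w x) * h (sort \<eta>) \<partial>count_space (configs k))"
    if "\<And>\<eta>. \<eta> \<in> ordered_configs k \<Longrightarrow> \<bar>h \<eta>\<bar> \<le> B'" for h B'
    unfolding T_def
  proof (rule tendsto_symmetric_sum_over_configs[OF pos _ summ lim])
    show "antimono w" using assms(6) by (simp add: w_def[abs_def])
    \<comment> \<open>Hypothesis (iii) is taken at \<open>l = Suc k\<close>, the number of
      coordinates sharing the total \<open>n\<close>.\<close>
    show "w (n div Suc k) \<le> C (Suc k) * w n" if "Suc k dvd n" for n
      using assms(7)[of "Suc k" n] that by (simp add: w_def)
  qed (rule that)
  have one: "(\<integral>\<eta>. (\<Prod>x\<leftarrow>\<eta>. w x) \<partial>count_space (configs k)) = Z ^ k"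
    using pos Z summ
    by (subst integral_eq_nn_integral)
       (auto simp: nn_integral_configs less_imp_le prod_list_map_nonneg Z_def
         partition_function_def w_def[abs_def])
  have "(\<lambda>n. T (\<lambda>_. 1) n / w n) \<longlonglongrightarrow> real (Suc k) * Z ^ k"
    using T[of "\<lambda>_. 1" 1] one by simp
  \<comment> \<open>In the quotient of the limits for \<open>g\<close> and for 1 the factors
    \<open>Suc k\<close> cancel, which leaves the grand canonical normalisation
    \<open>Z ^ k\<close>.\<close>
  from tendsto_divide[OF T[OF B] this]
  have "(\<lambda>n. (T g n / w n) / (T (\<lambda>_. 1) n / w n)) \<longlonglongrightarrow>
      (\<integral>\<eta>. (\<Prod>x\<leftarrow>\<eta>. w x) * g (sort \<eta>) \<partial>count_space (configs k)) / Z ^ k"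
    using Z by simp
  moreover have "integral\<^sup>L (ordered_grand_canonical f \<gamma> k) g =
      (\<integral>\<eta>. (\<Prod>x\<leftarrow>\<eta>. w x) * g (sort \<eta>) \<partial>count_space (configs k)) / Z ^ k"
    unfolding Z_def w_def
    using assms(1,2,5) by (intro integral_ordered_grand_canonical) auto
  moreover have "(T g n / w n) / (T (\<lambda>_. 1) n / w n) = integral\<^sup>L (cut_canonical f k n) g" for n
  proof -
    \<comment> \<open>All configurations of total \<open>n\<close> carry the same power
      \<open>\<gamma> ^ n\<close>, so it cancels between numerator and normaliser.\<close>
    have tilt: "T h n = \<gamma> ^ n * (\<Sum>\<xi> | \<xi> \<in> configs (Suc k) \<and> sum_list \<xi> = n.
        (\<Prod>x\<leftarrow>\<xi>. f x) * h (butlast (sort \<xi>)))" for h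
      unfolding T_def w_def prod_list_power_mult sum_distrib_left
      by (intro sum.cong) auto
    have "w n \<noteq> 0" using pos[of n] by simp
    then show ?thesis
      using assms(1) by (simp add: tilt integral_cut_canonical[OF assms(2)])
  qed
  ultimately show "(\<lambda>n. integral\<^sup>L (cut_canonical f (m - 1) n) g) \<longlonglongrightarrow>
      integral\<^sup>L (ordered_grand_canonical f \<gamma> (m - 1)) g"
    unfolding k_def by simp
qed

end
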